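(* In the weighted graph setting described in the context, define the $2|\partial\Omega|\times 2|\partial\Omega|$ matrix $$C=\begin{bmatrix}-D&S\\ H&D'\end{bmatrix}.$$ Then the matrices $P^\pm=\frac I2\mp C$ are projection matrices, i.e. $(P^+)^2=P^+$ and $(P^-)^2=P^-$.
   Context: Graph. $\mathcal G=(\mathcal V,\mathcal E)$ is a finite connected undirected graph without self-edges. $\mathcal V$ is partitioned into four nonempty disjoint sets $B,\Omega^+,\partial\Omega,\Omega^-$ such that, among pairs of distinct sets of the partition, the only ones joined by at least one edge are $\{B,\Omega^+\}$, $\{\Omega^+,\partial\Omega\}$, $\{\partial\Omega,\Omega^-\}$ (so there are no edges between $B$ and $\partial\Omega$, $B$ and $\Omega^-$, or $\Omega^+$ and $\Omega^-$). Put $\mathcal V^\circ=\mathcal V\setminus B$. Laplacian. The discrete gradient $\nabla$ is the $|\mathcal E|\times|\mathcal V|$ matrix with $(\nabla u)_k=u_i-u_j$, where $i,j$ are the endpoints of edge $k$ in a fixed order. For $s\in[0,\infty)^{|\mathcal E|}$, $L(s)=\nabla^T\mathrm{diag}(s)\nabla$. A conductivity $\sigma\in(0,\infty)^{|\mathcal E|}$ is fixed. $L[X,Y]$ denotes the submatrix with rows $X$, columns $Y$; $R_X$ is the $|X|\times|\mathcal V|$ matrix with $R_Xu=u|_X$. Green function. $G=R_{\mathcal V^\circ}^T\,L(\sigma)[\mathcal V^\circ,\mathcal V^\circ]^{-1}R_{\mathcal V^\circ}$ (the inverse exists since $\mathcal G$ is connected). Edge partition of unity. Let $\mathcal E^+$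 be the edges with at least one node in $B\cup\Omega^+$ and $\mathcal E^-$ the edges with at least one node in $\Omega^-$. Fix any $p^+,p^-\in[0,1]^{|\mathcal E|}$ with $p^++p^-=1$, $p^+|_{\mathcal E^+}=1$, $p^-|_{\mathcal E^-}=1$. Set $\sigma^\pm=p^\pm\sigma$ (componentwise), so $L(\sigma)=L(\sigma^+)+L(\sigma^-)$. Traces and potentials. $\gamma_0=R_{\partial\Omega}$, $\gamma_1^\pm=\mp R_{\partial\Omega}L(\sigma^\pm)$, $\mathcal S=G\gamma_0^T$, $\mathcal D^\pm=G[\gamma_1^\pm]^T$. Boundary layer operators ($|\partial\Omega|\times|\partial\Omega|$ matrices). $S=\gamma_0\mathcal S$, $D=\frac12\gamma_0(\mathcal D^++\mathcal D^-)$, $D'=\frac12(\gamma_1^++\gamma_1^-)\mathcal S=D^T$, $H=-\gamma_1^+\mathcal D^-$ (which coincides with $-\gamma_1^-\mathcal D^+$). *)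

theory Defs
  imports
    "Jordan_Normal_Form.Gauss_Jordan_Elimination"
    "Jordan_Normal_Form.DL_Submatrix"
    "HOL.Real"
begin

definition simple_graph :: "'v set \<Rightarrow> 'v set set \<Rightarrow> bool" where
  "simple_graph V E \<longleftrightarrow> finite V \<and> (\<forall>e\<in>E. e \<subseteq> V \<and> card e = 2)"

definition connected_graph :: "'v set \<Rightarrow> 'v set set \<Rightarrow> bool" where
  "connected_graph V E \<longleftrightarrow> (\<forall>u\<in>V. \<forall>v\<in>V. (u, v) \<in> {(x, y). {x, y} \<in> E}\<^sup>*)"

definition joined :: "'v set set \<Rightarrow> 'v set \<Rightarrow> 'v set \<Rightarrow> bool" where
  "joined E X Y \<longleftrightarrow> (\<exists>x\<in>X. \<exists>y\<in>Y. {x, y} \<in> E)"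

definition layer_partition ::
  "'v set \<Rightarrow> 'v set set \<Rightarrow> 'v set \<Rightarrow> 'v set \<Rightarrow> 'v set \<Rightarrow> 'v set \<Rightarrow> bool" where
  "layer_partition V E B Op dO Om \<longleftrightarrow>
     V = B \<union> Op \<union> dO \<union> Om \<and>
     B \<noteq> {} \<and> Op \<noteq> {} \<and> dO \<noteq> {} \<and> Om \<noteq> {} \<and>
     B \<inter> Op = {} \<and> B \<inter> dO = {} \<and> B \<inter> Om = {} \<and>
     Op \<inter> dO = {} \<and> Op \<inter> Om = {} \<and> dO \<inter> Om = {} \<and>
     joined E B Op \<and> joined E Op dO \<and> joined E dO Om \<and>
     \<not> joined E B dO \<and> \<not> joined E B Om \<and> \<not> joined E Op Om"

text \<open>Matrices and vectors are indexed by positions in an enumeration \<open>vs\<close> of the nodes and an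
  enumeration \<open>es\<close> of the edges.  Each edge occurs in \<open>es\<close> exactly once, as an ordered
  pair; that pair fixes the order of its endpoints.\<close>

definition edge_of :: "'v \<times> 'v \<Rightarrow> 'v set" where
  "edge_of e = {fst e, snd e}"

definition node_enum :: "'v set \<Rightarrow> 'v list \<Rightarrow> bool" where
  "node_enum V vs \<longleftrightarrow> distinct vs \<and> set vs = V"

definition edge_enum :: "'v set set \<Rightarrow> ('v \<times> 'v) list \<Rightarrow> bool" where
  "edge_enum E es \<longleftrightarrow> distinct (map edge_of es) \<and> set (map edge_of es) = E"

definition edge_partition_of_unity ::
  "('v \<times> 'v) list \<Rightarrow> 'v set \<Rightarrow> 'v set \<Rightarrow> 'v set \<Rightarrow> real vec \<Rightarrow> real vec \<Rightarrow> bool" where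
  "edge_partition_of_unity es B Op Om pp pm \<longleftrightarrow>
     pp \<in> carrier_vec (length es) \<and> pm \<in> carrier_vec (length es) \<and>
     (\<forall>k<length es. 0 \<le> pp $ k \<and> pp $ k \<le> 1 \<and> 0 \<le> pm $ k \<and> pm $ k \<le> 1 \<and> pp $ k + pm $ k = 1) \<and>
     (\<forall>k<length es. edge_of (es ! k) \<inter> (B \<union> Op) \<noteq> {} \<longrightarrow> pp $ k = 1) \<and>
     (\<forall>k<length es. edge_of (es ! k) \<inter> Om \<noteq> {} \<longrightarrow> pm $ k = 1)"

definition positions :: "'v list \<Rightarrow> 'v set \<Rightarrow> nat set" where
  "positions vs X = {i. i < length vs \<and> vs ! i \<in> X}"

text \<open>The matrix $R_X$: the rows of the identity matrix that belong to \<open>X\<close>.\<close>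

definition restr_mat :: "'v list \<Rightarrow> 'v set \<Rightarrow> real mat" where
  "restr_mat vs X = submatrix (1\<^sub>m (length vs)) (positions vs X) UNIV"

definition node_submatrix :: "'v list \<Rightarrow> real mat \<Rightarrow> 'v set \<Rightarrow> 'v set \<Rightarrow> real mat" where
  "node_submatrix vs A X Y = submatrix A (positions vs X) (positions vs Y)"

definition grad_mat :: "'v list \<Rightarrow> ('v \<times> 'v) list \<Rightarrow> real mat" where
  "grad_mat vs es = mat (length es) (length vs)
     (\<lambda>(k, i). (if vs ! i = fst (es ! k) then 1 else 0) - (if vs ! i = snd (es ! k) then 1 else 0))"

definition laplacian :: "'v list \<Rightarrow> ('v \<times> 'v) list \<Rightarrow> real vec \<Rightarrow> real mat" where
  "laplacian vs es s =
     transpose_mat (grad_mat vs es) * mat_diag (length es) (\<lambda>k. s $ k) * grad_mat vs es"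

definition vec_cmult :: "real vec \<Rightarrow> real vec \<Rightarrow> real vec" where
  "vec_cmult p s = vec (dim_vec s) (\<lambda>k. p $ k * s $ k)"

text \<open>Here \<open>the\<close> selects the inverse of $L(\sigma)[V^\circ, V^\circ]$, where
  $V^\circ = V \setminus B$; it is unspecified if that matrix is singular, which cannot happen for a
  connected graph, positive conductivity and nonempty \<open>B\<close>.\<close>

definition green_mat :: "'v list \<Rightarrow> ('v \<times> 'v) list \<Rightarrow> real vec \<Rightarrow> 'v set \<Rightarrow> real mat" where
  "green_mat vs es \<sigma> B =
     (let Vo = set vs - B in
      transpose_mat (restr_mat vs Vo)
        * the (mat_inverse (node_submatrix vs (laplacian vs es \<sigma>) Vo Vo))
        * restr_mat vs Vo)"

definition trace0 :: "'v list \<Rightarrow> 'v set \<Rightarrow> real mat" where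
  "trace0 vs dO = restr_mat vs dO"

text \<open>The two one-sided conormal traces carry opposite signs: $\gamma_1^\pm = \mp R L(\sigma^\pm)$.\<close>

definition trace1_plus ::
  "'v list \<Rightarrow> ('v \<times> 'v) list \<Rightarrow> real vec \<Rightarrow> 'v set \<Rightarrow> real vec \<Rightarrow> real mat" where
  "trace1_plus vs es \<sigma> dO pp = - (restr_mat vs dO * laplacian vs es (vec_cmult pp \<sigma>))"

definition trace1_minus ::
  "'v list \<Rightarrow> ('v \<times> 'v) list \<Rightarrow> real vec \<Rightarrow> 'v set \<Rightarrow> real vec \<Rightarrow> real mat" where
  "trace1_minus vs es \<sigma> dO pm = restr_mat vs dO * laplacian vs es (vec_cmult pm \<sigma>)"

definition single_layer ::
  "'v list \<Rightarrow> ('v \<times> 'v) list \<Rightarrow> real vec \<Rightarrow> 'v set \<Rightarrow> 'v set \<Rightarrow> real mat" where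
  "single_layer vs es \<sigma> B dO = green_mat vs es \<sigma> B * transpose_mat (trace0 vs dO)"

definition double_layer_plus ::
  "'v list \<Rightarrow> ('v \<times> 'v) list \<Rightarrow> real vec \<Rightarrow> 'v set \<Rightarrow> 'v set \<Rightarrow> real vec \<Rightarrow> real mat" where
  "double_layer_plus vs es \<sigma> B dO pp =
     green_mat vs es \<sigma> B * transpose_mat (trace1_plus vs es \<sigma> dO pp)"

definition double_layer_minus ::
  "'v list \<Rightarrow> ('v \<times> 'v) list \<Rightarrow> real vec \<Rightarrow> 'v set \<Rightarrow> 'v set \<Rightarrow> real vec \<Rightarrow> real mat" where
  "double_layer_minus vs es \<sigma> B dO pm =
     green_mat vs es \<sigma> B * transpose_mat (trace1_minus vs es \<sigma> dO pm)"

definition bl_S ::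
  "'v list \<Rightarrow> ('v \<times> 'v) list \<Rightarrow> real vec \<Rightarrow> 'v set \<Rightarrow> 'v set \<Rightarrow> real mat" where
  "bl_S vs es \<sigma> B dO = trace0 vs dO * single_layer vs es \<sigma> B dO"

definition bl_D ::
  "'v list \<Rightarrow> ('v \<times> 'v) list \<Rightarrow> real vec \<Rightarrow> 'v set \<Rightarrow> 'v set \<Rightarrow> real vec \<Rightarrow> real vec \<Rightarrow> real mat" where
  "bl_D vs es \<sigma> B dO pp pm =
     (1/2) \<cdot>\<^sub>m (trace0 vs dO * (double_layer_plus vs es \<sigma> B dO pp + double_layer_minus vs es \<sigma> B dO pm))"

definition bl_D' ::
  "'v list \<Rightarrow> ('v \<times> 'v) list \<Rightarrow> real vec \<Rightarrow> 'v set \<Rightarrow> 'v set \<Rightarrow> real vec \<Rightarrow> real vec \<Rightarrow> real mat" where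
  "bl_D' vs es \<sigma> B dO pp pm =
     (1/2) \<cdot>\<^sub>m ((trace1_plus vs es \<sigma> dO pp + trace1_minus vs es \<sigma> dO pm) * single_layer vs es \<sigma> B dO)"

definition bl_H ::
  "'v list \<Rightarrow> ('v \<times> 'v) list \<Rightarrow> real vec \<Rightarrow> 'v set \<Rightarrow> 'v set \<Rightarrow> real vec \<Rightarrow> real vec \<Rightarrow> real mat" where
  "bl_H vs es \<sigma> B dO pp pm =
     - (trace1_plus vs es \<sigma> dO pp * double_layer_minus vs es \<sigma> B dO pm)"

definition calderon_C ::
  "'v list \<Rightarrow> ('v \<times> 'v) list \<Rightarrow> real vec \<Rightarrow> 'v set \<Rightarrow> 'v set \<Rightarrow> real vec \<Rightarrow> real vec \<Rightarrow> real mat" where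
  "calderon_C vs es \<sigma> B dO pp pm =
     four_block_mat
       (- bl_D vs es \<sigma> B dO pp pm) (bl_S vs es \<sigma> B dO)
       (bl_H vs es \<sigma> B dO pp pm)   (bl_D' vs es \<sigma> B dO pp pm)"

definition calderon_P_plus ::
  "'v list \<Rightarrow> ('v \<times> 'v) list \<Rightarrow> real vec \<Rightarrow> 'v set \<Rightarrow> 'v set \<Rightarrow> real vec \<Rightarrow> real vec \<Rightarrow> real mat" where
  "calderon_P_plus vs es \<sigma> B dO pp pm =
     (1/2) \<cdot>\<^sub>m 1\<^sub>m (2 * card dO) - calderon_C vs es \<sigma> B dO pp pm"

definition calderon_P_minus ::
  "'v list \<Rightarrow> ('v \<times> 'v) list \<Rightarrow> real vec \<Rightarrow> 'v set \<Rightarrow> 'v set \<Rightarrow> real vec \<Rightarrow> real vec \<Rightarrow> real mat" where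
  "calderon_P_minus vs es \<sigma> B dO pp pm =
     (1/2) \<cdot>\<^sub>m 1\<^sub>m (2 * card dO) + calderon_C vs es \<sigma> B dO pp pm"

end

theory Submission
  imports Defs "Jordan_Normal_Form.Determinant"
begin

text \<open>Write $\gamma = \gamma_0$, $T^\pm = \gamma_1^\pm$ and let $Q_0$, $Q^+$, $Q^-$ be the coordinate
  projections onto $\partial\Omega$, $B \cup \Omega^+$ and $\Omega^-$.  Since $G L(\sigma) \gamma^T = \gamma^T$, the
  halves in $P^+$ are absorbed by the jump relations, and $P^+$ factors as
  $$P^+ = \begin{bmatrix} \gamma \cr T^+ \end{bmatrix} G \begin{bmatrix} (T^-)^T & -\gamma^T \end{bmatrix}.$$
  In $(P^+)^2$ the middle factor is
  $M = (T^-)^T \gamma - \gamma^T T^+ = L(\sigma^-) Q_0 + Q_0 L(\sigma^+) = L - L Q^- - Q^+ L$,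
  where the last step uses that $L(\sigma^+)$ vanishes on $\Omega^-$ and $L(\sigma^-)$ on $B \cup \Omega^+$.
  Hence $G M G = G - Q^- G - G Q^+$, and the two correction terms are annihilated by the outer
  factors.  Finally $P^- = I - P^+$.\<close>

section \<open>Matrix algebra with side conditions on dimensions\<close>

text \<open>The library rules speak of carriers, so rewriting with them has to guess the inner dimension.
  Conditions on \<^const>\<open>dim_row\<close> and \<^const>\<open>dim_col\<close> are computed by the simplifier.\<close>

lemma mult_assoc_dim:
  fixes A B C :: "'a :: semiring_0 mat"
  assumes "dim_col A = dim_row B" "dim_col B = dim_row C"
  shows "A * B * C = A * (B * C)"
  using assms by (intro assoc_mult_mat[of A "dim_row A" "dim_row B" B "dim_row C" C "dim_col C"] carrier_matI) auto

lemma mult_add_distrib_dim: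
  fixes A B C :: "'a :: semiring_0 mat"
  assumes "dim_col A = dim_row B" "dim_row B = dim_row C" "dim_col B = dim_col C"
  shows "A * (B + C) = A * B + A * C"
  using assms by (intro mult_add_distrib_mat[of A "dim_row A" "dim_row B" B "dim_col B"] carrier_matI) auto

lemma add_mult_distrib_dim:
  fixes A B C :: "'a :: semiring_0 mat"
  assumes "dim_row A = dim_row B" "dim_col A = dim_col B" "dim_col B = dim_row C"
  shows "(A + B) * C = A * C + B * C"
  using assms by (intro add_mult_distrib_mat[of A "dim_row A" "dim_col A" B C "dim_col C"] carrier_matI) auto

lemma transpose_mult_dim:
  fixes A B :: "'a :: comm_semiring_0 mat"
  assumes "dim_col A = dim_row B"
  shows "transpose_mat (A * B) = transpose_mat B * transpose_mat A"
  using assms by (intro transpose_mult[of A "dim_row A" "dim_row B" B "dim_col B"] carrier_matI) auto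

lemma mult_zero_dim:
  fixes A :: "'a :: semiring_0 mat"
  shows "dim_col A = n \<Longrightarrow> A * 0\<^sub>m n k = 0\<^sub>m (dim_row A) k"
    "dim_row A = n \<Longrightarrow> 0\<^sub>m k n * A = 0\<^sub>m k (dim_col A)"
  by (auto intro!: eq_matI simp: scalar_prod_def)

lemma add_zero_dim:
  fixes A :: "'a :: monoid_add mat"
  shows "dim_row A = n \<Longrightarrow> dim_col A = k \<Longrightarrow> A + 0\<^sub>m n k = A"
  by (rule eq_matI) auto

lemmas mat_dim_algebra = mult_assoc_dim mult_add_distrib_dim add_mult_distrib_dim

text \<open>\<open>F\<close> is the column (\<open>a1\<close>, \<open>a2\<close>) times
  \<open>G\<close> times the row (\<open>b1\<close>, \<open>b2\<close>), so squaring it puts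
  \<open>b1 * a1 + b2 * a2\<close> between two copies of \<open>G\<close>. The condition
  \<open>sandwich\<close> is asked for only between outer factors, since
  \<open>G * M * G = G\<close> itself fails in the application.\<close>

lemma four_block_sandwich_idem:
  fixes G :: "'a :: semiring_0 mat"
  assumes dims: "a1 \<in> carrier_mat m n" "a2 \<in> carrier_mat m n" "b1 \<in> carrier_mat n m"
      "b2 \<in> carrier_mat n m" "G \<in> carrier_mat n n"
    and sandwich: "\<And>a b. a \<in> {a1, a2} \<Longrightarrow> b \<in> {b1, b2} \<Longrightarrow>
      a * (G * (b1 * a1 + b2 * a2) * G) * b = a * G * b"
  defines "F \<equiv> four_block_mat (a1 * G * b1) (a1 * G * b2) (a2 * G * b1) (a2 * G * b2)"
  shows "F * F = F"
proof -
  note d = dims[THEN carrier_matD(1)] dims[THEN carrier_matD(2)]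
  have block: "a * G * b1 * (a1 * G * b) + a * G * b2 * (a2 * G * b) = a * G * b"
    if "a \<in> {a1, a2}" "b \<in> {b1, b2}" for a b
    using that by (subst sandwich[OF that, symmetric]) (auto simp: mat_dim_algebra d)
  have carrier: "a * G * b \<in> carrier_mat m m" if "a \<in> {a1, a2}" "b \<in> {b1, b2}" for a b
    using that by (auto simp: d)
  show ?thesis
    unfolding F_def
    by (subst mult_four_block_mat[where ?nr1.0 = m and ?nr2.0 = m and ?n1.0 = m and ?n2.0 = m
          and ?nc1.0 = m and ?nc2.0 = m]) (simp_all add: carrier block)
qed

section \<open>Restriction matrices\<close>

text \<open>The coordinate projection onto \<open>X\<close>, kept at full size so that projections
  onto different node sets can be multiplied with each other and with the Laplacian. By
  \<open>transpose_mult_restr_mat\<close> it is R_X^T R_X.\<close>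

definition ind_mat :: "'v list \<Rightarrow> 'v set \<Rightarrow> real mat" where
  "ind_mat vs X = mat_diag (length vs) (\<lambda>i. if vs ! i \<in> X then 1 else 0)"

lemma finite_positions [simp]: "finite (positions vs X)"
  by (simp add: positions_def)

lemma positions_Collect: "{i. i < length vs \<and> i \<in> positions vs X} = positions vs X"
  by (auto simp: positions_def)

lemma card_positions:
  assumes "distinct vs" "X \<subseteq> set vs"
  shows "card (positions vs X) = card X"
proof -
  have "bij_betw (nth vs) (positions vs X) X"
    unfolding bij_betw_def
  proof
    show "inj_on (nth vs) (positions vs X)"
      using assms(1) by (auto simp: inj_on_def positions_def nth_eq_iff_index_eq)
    show "nth vs ` positions vs X = X"
      using assms(2) by (auto simp: positions_def in_set_conv_nth image_iff subset_eq)
  qed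
  then show ?thesis by (rule bij_betw_same_card)
qed

text \<open>\<open>pick P\<close> is strictly increasing, hence injective into \<open>P\<close>, and
  a cardinality count makes it onto. This permits reindexing between row numbers of a restriction
  matrix and positions in \<open>vs\<close>.\<close>

lemma pick_bij_betw:
  assumes "finite P"
  shows "bij_betw (pick P) {..<card P} P"
proof -
  have inj: "inj_on (pick P) {..<card P}"
    using pick_mono_le[of _ P] by (intro linorder_inj_onI) (auto simp: less_le)
  have "pick P ` {..<card P} \<subseteq> P"
    using pick_in_set_le by auto
  then have "pick P ` {..<card P} = P"
    using card_image[OF inj] assms by (intro card_subset_eq) auto
  with inj show ?thesis by (simp add: bij_betw_def)
qed

lemma pick_positions:
  assumes "a < card (positions vs X)"
  shows "pick (positions vs X) a < length vs" "vs ! pick (positions vs X) a \<in> X"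
  using pick_in_set_le[OF assms] by (auto simp: positions_def)

lemma restr_mat_carrier [simp]:
  "restr_mat vs X \<in> carrier_mat (card (positions vs X)) (length vs)"
  unfolding restr_mat_def by (rule carrier_matI) (simp_all add: dim_submatrix positions_Collect)

lemma dim_restr_mat [simp]:
  "dim_row (restr_mat vs X) = card (positions vs X)" "dim_col (restr_mat vs X) = length vs"
  by (rule carrier_matD[OF restr_mat_carrier])+

lemma restr_mat_index:
  assumes "a < card (positions vs X)" "j < length vs"
  shows "restr_mat vs X $$ (a, j) = (if pick (positions vs X) a = j then 1 else 0)"
  unfolding restr_mat_def using assms pick_positions(1)[OF assms(1)]
  by (subst submatrix_index) (simp_all add: positions_Collect pick_UNIV)

lemma ind_mat_carrier [simp]: "ind_mat vs X \<in> carrier_mat (length vs) (length vs)"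
  by (simp add: ind_mat_def)

lemma dim_ind_mat [simp]:
  "dim_row (ind_mat vs X) = length vs" "dim_col (ind_mat vs X) = length vs"
  by (rule carrier_matD[OF ind_mat_carrier])+

lemma ind_mat_mult: "ind_mat vs X * ind_mat vs Y = ind_mat vs (X \<inter> Y)"
  unfolding ind_mat_def mat_diag_diag by (rule arg_cong[of _ _ "mat_diag (length vs)"]) auto

lemma ind_mat_mult_left:
  assumes "A \<in> carrier_mat (length vs) k"
  shows "ind_mat vs X * A = mat (length vs) k (\<lambda>(i, j). if vs ! i \<in> X then A $$ (i, j) else 0)"
  unfolding ind_mat_def mat_diag_mult_left[OF assms] by (rule eq_matI) auto

lemma ind_mat_mult_right:
  assumes "A \<in> carrier_mat k (length vs)"
  shows "A * ind_mat vs X = mat k (length vs) (\<lambda>(i, j). if vs ! j \<in> X then A $$ (i, j) else 0)"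
  unfolding ind_mat_def mat_diag_mult_right[OF assms] by (rule eq_matI) auto

lemma restr_mat_mult_index:
  assumes "A \<in> carrier_mat (length vs) k" "a < card (positions vs X)" "j < k"
  shows "(restr_mat vs X * A) $$ (a, j) = A $$ (pick (positions vs X) a, j)"
  using assms pick_positions(1)[OF assms(2)]
  by (simp add: scalar_prod_def restr_mat_index if_distrib[of "\<lambda>x. x * _"] cong: if_cong)

lemma mult_restr_mat_transpose_index:
  assumes "A \<in> carrier_mat k (length vs)" "i < k" "b < card (positions vs X)"
  shows "(A * transpose_mat (restr_mat vs X)) $$ (i, b) = A $$ (i, pick (positions vs X) b)"
  using assms pick_positions(1)[OF assms(3)]
  by (simp add: scalar_prod_def restr_mat_index if_distrib[of "\<lambda>x. _ * x"] cong: if_cong)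

text \<open>Multiplying by R_X on the left picks rows and by R_Y^T on the right picks columns. From
  here on submatrices are handled by matrix algebra alone.\<close>

lemma node_submatrix_conv:
  assumes "A \<in> carrier_mat (length vs) (length vs)"
  shows "node_submatrix vs A X Y = restr_mat vs X * A * transpose_mat (restr_mat vs Y)"
proof (rule eq_matI)
  fix i j
  assume "i < dim_row (restr_mat vs X * A * transpose_mat (restr_mat vs Y))"
    and "j < dim_col (restr_mat vs X * A * transpose_mat (restr_mat vs Y))"
  then have ij: "i < card (positions vs X)" "j < card (positions vs Y)" by auto
  have RA: "restr_mat vs X * A \<in> carrier_mat (card (positions vs X)) (length vs)"
    using assms by (intro mult_carrier_mat[of _ _ "length vs"]) auto
  show "node_submatrix vs A X Y $$ (i, j) =
      (restr_mat vs X * A * transpose_mat (restr_mat vs Y)) $$ (i, j)"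
    unfolding node_submatrix_def mult_restr_mat_transpose_index[OF RA ij]
      restr_mat_mult_index[OF assms ij(1) pick_positions(1)[OF ij(2)]]
    using ij assms by (subst submatrix_index) (simp_all add: positions_Collect)
qed (use assms in \<open>simp_all add: node_submatrix_def dim_submatrix positions_Collect\<close>)

lemma restr_mat_mult_transpose:
  "restr_mat vs X * transpose_mat (restr_mat vs X) = 1\<^sub>m (card (positions vs X))"
proof (rule eq_matI)
  fix a b
  assume "a < dim_row (1\<^sub>m (card (positions vs X)) :: real mat)"
    and "b < dim_col (1\<^sub>m (card (positions vs X)) :: real mat)"
  then have ab: "a < card (positions vs X)" "b < card (positions vs X)" by auto
  have "inj_on (pick (positions vs X)) {..<card (positions vs X)}"
    using pick_bij_betw[OF finite_positions] by (rule bij_betw_imp_inj_on)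
  then have "pick (positions vs X) a = pick (positions vs X) b \<longleftrightarrow> a = b"
    using ab by (auto dest: inj_onD)
  then show "(restr_mat vs X * transpose_mat (restr_mat vs X)) $$ (a, b) =
      1\<^sub>m (card (positions vs X)) $$ (a, b)"
    using ab pick_positions(1)[OF ab(2)]
    by (subst mult_restr_mat_transpose_index) (auto simp: restr_mat_index)
qed auto

text \<open>Entry (i, j) is a sum of products of Kronecker deltas over row numbers. Reindexed by
  \<open>pick\<close> it runs over the positions of \<open>X\<close>, where only the position
  \<open>i\<close> can contribute, and only if \<open>i = j\<close>.\<close>

lemma transpose_mult_restr_mat:
  "transpose_mat (restr_mat vs X) * restr_mat vs X = ind_mat vs X"
proof (rule eq_matI)
  fix i j assume "i < dim_row (ind_mat vs X)" "j < dim_col (ind_mat vs X)"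
  then have ij: "i < length vs" "j < length vs" by auto
  let ?P = "positions vs X"
  have "(transpose_mat (restr_mat vs X) * restr_mat vs X) $$ (i, j) =
      (\<Sum>a<card ?P. (if pick ?P a = i then 1 else 0) * (if pick ?P a = j then 1 else 0))"
    using ij by (simp add: scalar_prod_def restr_mat_index lessThan_atLeast0)
  also have "\<dots> = (\<Sum>p\<in>?P. (if p = i then 1 else 0) * (if p = j then 1 else 0))"
    using pick_bij_betw[OF finite_positions] by (rule sum.reindex_bij_betw)
  also have "\<dots> = (\<Sum>p\<in>?P. if p = i then if i = j then 1 else 0 else 0)"
    by (rule sum.cong) auto
  also have "\<dots> = ind_mat vs X $$ (i, j)"
    using ij by (auto simp: ind_mat_def mat_diag_def positions_def)
  finally show "(transpose_mat (restr_mat vs X) * restr_mat vs X) $$ (i, j) = ind_mat vs X $$ (i, j)" .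
qed auto

lemma restr_mat_mult_ind_mat:
  assumes "X \<subseteq> Y"
  shows "restr_mat vs X * ind_mat vs Y = restr_mat vs X"
  using assms
  by (auto intro!: eq_matI dest!: pick_positions(2) simp: ind_mat_mult_right[OF restr_mat_carrier] restr_mat_index)

lemma restr_mat_mult_ind_mat_disjoint:
  assumes "X \<inter> Y = {}"
  shows "restr_mat vs X * ind_mat vs Y = 0\<^sub>m (card (positions vs X)) (length vs)"
  using assms
  by (auto intro!: eq_matI dest!: pick_positions(2) simp: ind_mat_mult_right[OF restr_mat_carrier] restr_mat_index)

section \<open>The Dirichlet Laplacian\<close>

lemma grad_mat_carrier [simp]: "grad_mat vs es \<in> carrier_mat (length es) (length vs)"
  by (simp add: grad_mat_def)

lemma laplacian_carrier [simp]: "laplacian vs es s \<in> carrier_mat (length vs) (length vs)"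
  unfolding laplacian_def
  by (intro mult_carrier_mat[of _ _ "length es"] mat_diag_dim) simp_all

lemma dim_laplacian [simp]:
  "dim_row (laplacian vs es s) = length vs" "dim_col (laplacian vs es s) = length vs"
  by (rule carrier_matD[OF laplacian_carrier])+

lemma laplacian_index:
  assumes "i < length vs" "j < length vs"
  shows "laplacian vs es s $$ (i, j) =
    (\<Sum>k<length es. s $ k * grad_mat vs es $$ (k, i) * grad_mat vs es $$ (k, j))"
proof -
  let ?g = "grad_mat vs es"
  have gT: "transpose_mat ?g \<in> carrier_mat (length vs) (length es)" by simp
  show ?thesis
    using assms unfolding laplacian_def mat_diag_mult_right[OF gT]
    by (subst index_mult_mat)
      (auto simp: scalar_prod_def lessThan_atLeast0 mult_ac carrier_matD[OF grad_mat_carrier])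
qed

lemma transpose_laplacian [simp]: "transpose_mat (laplacian vs es s) = laplacian vs es s"
  by (rule eq_matI) (simp_all add: laplacian_index mult_ac)

text \<open>An edge enters row or column \<open>i\<close> only through its gradient entry at
  \<open>i\<close>, which is zero unless node \<open>i\<close> is an endpoint.\<close>

lemma laplacian_eq_0:
  assumes "i < length vs" "j < length vs"
    and "\<And>k. k < length es \<Longrightarrow> vs ! i \<in> edge_of (es ! k) \<Longrightarrow> s $ k = 0"
  shows "laplacian vs es s $$ (i, j) = 0" "laplacian vs es s $$ (j, i) = 0"
  using assms by (auto intro!: sum.neutral simp: laplacian_index grad_mat_def edge_of_def)

lemma laplacian_add:
  assumes "\<And>k. k < length es \<Longrightarrow> s $ k = s1 $ k + s2 $ k"
  shows "laplacian vs es s = laplacian vs es s1 + laplacian vs es s2"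
  using assms by (intro eq_matI) (simp_all add: laplacian_index flip: sum.distrib, simp add: algebra_simps)

text \<open>The Dirichlet energy: the transposed gradient moves to the other side of the scalar
  product. For positive weights, zero energy forces a zero gradient.\<close>

lemma laplacian_quadratic_form:
  assumes "u \<in> carrier_vec (length vs)"
  shows "u \<bullet> (laplacian vs es s *\<^sub>v u) = (\<Sum>k<length es. s $ k * ((grad_mat vs es *\<^sub>v u) $ k)\<^sup>2)"
proof -
  let ?g = "grad_mat vs es" and ?D = "mat_diag (length es) (\<lambda>k. s $ k)"
  have gu: "?g *\<^sub>v u \<in> carrier_vec (length es)"
    using assms by (intro mult_mat_vec_carrier[of _ _ "length vs"]) auto
  have Dgu: "?D *\<^sub>v (?g *\<^sub>v u) \<in> carrier_vec (length es)"
    by (rule mult_mat_vec_carrier[OF mat_diag_dim gu])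
  have "laplacian vs es s *\<^sub>v u = transpose_mat ?g *\<^sub>v (?D *\<^sub>v (?g *\<^sub>v u))"
    unfolding laplacian_def
    using assms gu
    by (subst assoc_mult_mat_vec[of _ "length vs" "length es" _ "length vs"])
      (auto intro!: mult_carrier_mat[of _ _ "length es"]
        assoc_mult_mat_vec[of _ "length vs" "length es" _ "length es"])
  then have "u \<bullet> (laplacian vs es s *\<^sub>v u) = (transpose_mat ?g *\<^sub>v (?D *\<^sub>v (?g *\<^sub>v u))) \<bullet> u"
    using assms Dgu by (metis comm_scalar_prod grad_mat_carrier mult_mat_vec_carrier transpose_carrier_mat)
  also have "\<dots> = (?D *\<^sub>v (?g *\<^sub>v u)) \<bullet> (?g *\<^sub>v u)"
    by (rule transpose_vec_mult_scalar[OF grad_mat_carrier assms Dgu])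
  also have "\<dots> = (\<Sum>k<length es. (?D *\<^sub>v (?g *\<^sub>v u)) $ k * (?g *\<^sub>v u) $ k)"
    using carrier_vecD[OF gu]
    by (simp add: scalar_prod_def lessThan_atLeast0 del: index_mult_mat_vec dim_mult_mat_vec)
  also have "\<dots> = (\<Sum>k<length es. s $ k * ((?g *\<^sub>v u) $ k)\<^sup>2)"
  proof (rule sum.cong)
    fix k assume "k \<in> {..<length es}"
    then have k: "k < length es" by simp
    have "(?D *\<^sub>v w) $ k = s $ k * w $ k" if w: "w \<in> carrier_vec (length es)" for w
      using k w
      by (simp add: mat_diag_def scalar_prod_def if_distrib[of "\<lambda>x. x * _"] cong: if_cong)
    from this[OF gu] show "(?D *\<^sub>v (?g *\<^sub>v u)) $ k * (?g *\<^sub>v u) $ k = s $ k * ((?g *\<^sub>v u) $ k)\<^sup>2"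
      by (simp only: power2_eq_square mult.assoc)
  qed simp
  finally show ?thesis .
qed

lemma grad_mat_mult_vec:
  assumes "distinct vs" "k < length es" "i < length vs" "j < length vs" "es ! k = (vs ! i, vs ! j)"
    and "u \<in> carrier_vec (length vs)"
  shows "(grad_mat vs es *\<^sub>v u) $ k = u $ i - u $ j"
proof -
  have "(grad_mat vs es *\<^sub>v u) $ k =
      (\<Sum>l<length vs. (if l = i then u $ i else 0) - (if l = j then u $ j else 0))"
    using assms by (auto simp: grad_mat_def scalar_prod_def lessThan_atLeast0 nth_eq_iff_index_eq intro!: sum.cong)
  then show ?thesis using assms by (simp add: sum_subtractf)
qed

text \<open>A zero gradient equates the values at the two ends of each edge, and connectedness
  carries the equality along a path.\<close>

lemma grad_kernel_constant:
  assumes conn: "connected_graph V E" and enum: "node_enum V vs" "edge_enum E es"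
    and u: "u \<in> carrier_vec (length vs)"
    and zero: "\<And>k. k < length es \<Longrightarrow> (grad_mat vs es *\<^sub>v u) $ k = 0"
    and simple: "simple_graph V E"
    and ij: "i < length vs" "j < length vs"
  shows "u $ i = u $ j"
proof -
  have vs: "distinct vs" "set vs = V" using enum(1) by (auto simp: node_enum_def)
  have edge: "u $ a = u $ b" if ab: "a < length vs" "b < length vs" "{vs ! a, vs ! b} \<in> E" for a b
  proof -
    have "{vs ! a, vs ! b} \<in> edge_of ` set es"
      using ab(3) enum(2) by (simp add: edge_enum_def)
    then obtain k where k: "k < length es" "edge_of (es ! k) = {vs ! a, vs ! b}"
      by (metis imageE in_set_conv_nth)
    \<comment> \<open>The edge as a set does not reveal the orientation chosen in \<open>es\<close>,
      so both orders occur.\<close>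
    then have "es ! k = (vs ! a, vs ! b) \<or> es ! k = (vs ! b, vs ! a)"
      unfolding edge_of_def doubleton_eq_iff prod_eq_iff by simp
    then show ?thesis
    proof
      assume "es ! k = (vs ! a, vs ! b)"
      from grad_mat_mult_vec[OF vs(1) k(1) ab(1,2) this u] show ?thesis by (simp only: zero[OF k(1)])
    next
      assume "es ! k = (vs ! b, vs ! a)"
      from grad_mat_mult_vec[OF vs(1) k(1) ab(2,1) this u] show ?thesis by (simp only: zero[OF k(1)])
    qed
  qed
  have "(vs ! i, vs ! j) \<in> {(x, y). {x, y} \<in> E}\<^sup>*"
    using conn nth_mem[OF ij(1)] nth_mem[OF ij(2)] unfolding connected_graph_def vs(2) by blast
  \<comment> \<open>The path runs through nodes while \<open>u\<close> is indexed by positions, so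
    the induction carries a position \<open>b\<close> of the current node. Distinctness of
    \<open>vs\<close> finally gives \<open>b = j\<close>.\<close>
  then have "\<exists>b<length vs. vs ! b = vs ! j \<and> u $ i = u $ b"
  proof (induction rule: rtrancl_induct)
    case base
    then show ?case using ij by blast
  next
    case (step y z)
    then obtain b where b: "b < length vs" "vs ! b = y" "u $ i = u $ b" by blast
    have "z \<in> V" using step.hyps(2) simple by (auto simp: simple_graph_def)
    then obtain c where c: "c < length vs" "vs ! c = z" using vs(2) by (metis in_set_conv_nth)
    have "u $ b = u $ c" using edge[of b c] b c step.hyps(2) by auto
    with b c show ?case by auto
  qed
  then show ?thesis using vs(1) ij by (auto simp: nth_eq_iff_index_eq)
qed

text \<open>A kernel vector of the Dirichlet block, extended by zero to \<open>B\<close>, has zero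
  energy. It is therefore constant, and it vanishes at some node of \<open>B\<close>, so it is zero.
  This justifies the \<open>the\<close> in \<open>green_mat\<close>.\<close>

lemma dirichlet_laplacian_inverse:
  assumes graph: "simple_graph V E" "connected_graph V E"
    and enum: "node_enum V vs" "edge_enum E es"
    and pos: "\<forall>k<length es. 0 < s $ k"
    and B: "B \<noteq> {}" "B \<subseteq> V"
  defines "A \<equiv> node_submatrix vs (laplacian vs es s) (V - B) (V - B)"
    and "N \<equiv> card (positions vs (V - B))"
  shows "A * the (mat_inverse A) = 1\<^sub>m N" "the (mat_inverse A) * A = 1\<^sub>m N"
    "the (mat_inverse A) \<in> carrier_mat N N"
proof -
  let ?R = "restr_mat vs (V - B)" and ?L = "laplacian vs es s" and ?n = "length vs"
  have R: "?R \<in> carrier_mat N ?n" by (simp add: N_def)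
  have A_eq: "A = ?R * ?L * transpose_mat ?R"
    by (simp add: A_def node_submatrix_conv)
  have RL: "?R * ?L \<in> carrier_mat N ?n"
    using R by (intro mult_carrier_mat[of _ _ ?n]) auto
  have A: "A \<in> carrier_mat N N"
    unfolding A_eq using R RL by (intro mult_carrier_mat[of _ _ ?n]) auto
  have "v = 0\<^sub>v N" if v: "v \<in> carrier_vec N" and Av: "A *\<^sub>v v = 0\<^sub>v N" for v
  proof -
    \<comment> \<open>The extension of \<open>v\<close> by zero to the nodes of
      \<open>B\<close>.\<close>
    define u where "u = transpose_mat ?R *\<^sub>v v"
    have u: "u \<in> carrier_vec ?n"
      unfolding u_def using R v by (intro mult_mat_vec_carrier[of _ _ N]) auto
    have Lu: "?L *\<^sub>v u \<in> carrier_vec ?n"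
      using u by (intro mult_mat_vec_carrier[of _ _ ?n]) auto
    have RLu: "?R *\<^sub>v (?L *\<^sub>v u) = A *\<^sub>v v"
      unfolding A_eq u_def using R v RL u[unfolded u_def]
      by (subst assoc_mult_mat_vec[of _ N ?n _ N]) (auto simp: assoc_mult_mat_vec[of _ N ?n _ ?n])
    have "u \<bullet> (?L *\<^sub>v u) = v \<bullet> (?R *\<^sub>v (?L *\<^sub>v u))"
      unfolding u_def by (rule transpose_vec_mult_scalar[OF R _ v]) (use Lu in \<open>simp add: u_def\<close>)
    also have "\<dots> = 0" using v by (simp add: RLu Av)
    finally have "(\<Sum>k<length es. s $ k * ((grad_mat vs es *\<^sub>v u) $ k)\<^sup>2) = 0"
      by (simp add: laplacian_quadratic_form[OF u])
    moreover have "0 \<le> s $ k * ((grad_mat vs es *\<^sub>v u) $ k)\<^sup>2" if "k \<in> {..<length es}" for k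
      using pos that by (intro mult_nonneg_nonneg) (auto intro: less_imp_le)
    ultimately have "\<forall>k\<in>{..<length es}. s $ k * ((grad_mat vs es *\<^sub>v u) $ k)\<^sup>2 = 0"
      by (subst (asm) sum_nonneg_eq_0_iff) auto
    then have grad0: "(grad_mat vs es *\<^sub>v u) $ k = 0" if "k < length es" for k
      using that pos by (metis lessThan_iff mult_eq_0_iff order_less_irrefl power_not_zero)
    obtain b where b: "b < ?n" "vs ! b \<in> B"
      using B enum(1) by (auto simp: node_enum_def) (metis in_set_conv_nth subset_eq)
    have Ru: "?R *\<^sub>v u = v"
      unfolding u_def using R v
      by (subst assoc_mult_mat_vec[symmetric, of _ N ?n _ N])
        (auto simp: restr_mat_mult_transpose N_def)
    \<comment> \<open>Being an extension by zero, \<open>u\<close> is fixed by the projection onto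
      \<open>V - B\<close>, which makes its entry at \<open>b\<close> zero.\<close>
    have "u = transpose_mat ?R *\<^sub>v (?R *\<^sub>v u)" by (simp only: Ru) (simp only: u_def)
    also have "\<dots> = (transpose_mat ?R * ?R) *\<^sub>v u"
      using R u by (intro assoc_mult_mat_vec[symmetric, of _ ?n N _ ?n]) auto
    finally have "u = ind_mat vs (V - B) *\<^sub>v u"
      by (simp only: transpose_mult_restr_mat)
    then have "u $ b = (ind_mat vs (V - B) *\<^sub>v u) $ b" by simp
    also have "\<dots> = 0"
      using b u by (auto simp: ind_mat_def mat_diag_def scalar_prod_def intro!: sum.neutral)
    finally have "u $ i = 0" if "i < ?n" for i
      using grad_kernel_constant[OF graph(2) enum u grad0 graph(1) that b(1)] by simp
    then have "u = 0\<^sub>v ?n" using u by auto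
    with Ru R show ?thesis by (auto simp: scalar_prod_def intro!: eq_vecI)
  qed
  then have "det A \<noteq> 0" using det_0_iff_vec_prod_zero_field[OF A] by auto
  then have "A \<in> Units (ring_mat TYPE(real) N ())"
    by (rule det_non_zero_imp_unit[OF A])
  \<comment> \<open>\<open>mat_inverse\<close> returns \<open>None\<close> only on non-units, which
    the nonzero determinant excludes.\<close>
  then obtain C where C: "mat_inverse A = Some C"
    using mat_inverse(1)[OF A, where b = "()"] by (cases "mat_inverse A") auto
  from mat_inverse(2)[OF A this]
  show "A * the (mat_inverse A) = 1\<^sub>m N" "the (mat_inverse A) * A = 1\<^sub>m N"
    "the (mat_inverse A) \<in> carrier_mat N N"
    by (auto simp: C)
qed

section \<open>The Green function\<close>

lemma ind_mat_mult_restr_transpose: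
  assumes "X \<subseteq> Y"
  shows "ind_mat vs Y * transpose_mat (restr_mat vs X) = transpose_mat (restr_mat vs X)"
proof -
  have "transpose_mat (ind_mat vs Y) = ind_mat vs Y"
    by (auto intro!: eq_matI simp: ind_mat_def mat_diag_def)
  then show ?thesis
    using arg_cong[OF restr_mat_mult_ind_mat[OF assms, of vs], of transpose_mat]
    by (simp add: transpose_mult_dim)
qed

context
  fixes V B :: "'v set" and E :: "'v set set" and vs :: "'v list" and es :: "('v \<times> 'v) list"
    and s :: "real vec"
  assumes graph: "simple_graph V E" "connected_graph V E"
    and enum: "node_enum V vs" "edge_enum E es"
    and pos: "\<forall>k<length es. 0 < s $ k"
    and B: "B \<noteq> {}" "B \<subseteq> V"
begin

text \<open>With R the restriction to \<open>V - B\<close>, A the Dirichlet block R L R^T and C its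
  inverse, G = R^T C R. Hence G L R^T = R^T C A = R^T and R L G = A C R = R. Thus G inverts L only
  next to a projection onto nodes off \<open>B\<close>, while G itself has zero rows and columns at
  \<open>B\<close>.\<close>

lemma green_mat_carrier: "green_mat vs es s B \<in> carrier_mat (length vs) (length vs)"
  and green_laplacian: "X \<subseteq> V - B \<Longrightarrow>
    green_mat vs es s B * (laplacian vs es s * ind_mat vs X) = ind_mat vs X"
  and laplacian_green: "X \<subseteq> V - B \<Longrightarrow>
    ind_mat vs X * (laplacian vs es s * green_mat vs es s B) = ind_mat vs X"
  and green_ind: "green_mat vs es s B * ind_mat vs (V - B) = green_mat vs es s B"
  and ind_green: "ind_mat vs (V - B) * green_mat vs es s B = green_mat vs es s B"
proof -
  let ?L = "laplacian vs es s" and ?G = "green_mat vs es s B" and ?R = "restr_mat vs (V - B)"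
  define A where "A = node_submatrix vs ?L (V - B) (V - B)"
  define C where "C = the (mat_inverse A)"
  let ?N = "card (positions vs (V - B))"
  note inv = dirichlet_laplacian_inverse[OF graph enum pos B, folded A_def, folded C_def]
  have C: "dim_row C = ?N" "dim_col C = ?N" using inv(3) by auto
  have A_eq: "A = ?R * (?L * transpose_mat ?R)"
    by (simp add: A_def node_submatrix_conv mult_assoc_dim)
  have G: "?G = transpose_mat ?R * (C * ?R)"
    using enum(1) by (simp add: green_mat_def Let_def node_enum_def A_def C_def mult_assoc_dim
        flip: A_def C_def)
      (simp add: mult_assoc_dim C)
  show carrier: "?G \<in> carrier_mat (length vs) (length vs)"
    unfolding G by (rule carrier_matI) (simp_all add: C)
  then have dG: "dim_row ?G = length vs" "dim_col ?G = length vs" by auto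
  show "?G * ind_mat vs (V - B) = ?G"
    by (simp add: G mult_assoc_dim C restr_mat_mult_ind_mat)
  show "ind_mat vs (V - B) * ?G = ?G"
    by (simp add: G C ind_mat_mult_restr_transpose flip: mult_assoc_dim)
  have GLR: "?G * (?L * transpose_mat ?R) = transpose_mat ?R"
  proof -
    have "?G * (?L * transpose_mat ?R) = transpose_mat ?R * (C * A)"
      by (simp add: G A_eq C mult_assoc_dim)
    then show ?thesis using inv(2) by simp
  qed
  have RLG: "?R * (?L * ?G) = ?R"
  proof -
    have "?R * (?L * ?G) = A * C * ?R"
      by (simp add: G A_eq C mult_assoc_dim)
    then show ?thesis using inv(1) by simp
  qed
  assume X: "X \<subseteq> V - B"
  \<comment> \<open>Since \<open>X\<close> avoids \<open>B\<close>, its projection factors through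
    R^T on the left and through R on the right, so the two identities for R transfer to it.\<close>
  have X1: "ind_mat vs X = transpose_mat ?R * (?R * ind_mat vs X)"
    using X by (simp add: transpose_mult_restr_mat ind_mat_mult Int_absorb1 flip: mult_assoc_dim)
  have X2: "ind_mat vs X = ind_mat vs X * transpose_mat ?R * ?R"
    using X by (simp add: mult_assoc_dim transpose_mult_restr_mat ind_mat_mult Int_absorb2)
  have "?G * (?L * ind_mat vs X) = ?G * (?L * transpose_mat ?R) * (?R * ind_mat vs X)"
    by (subst X1) (simp add: mult_assoc_dim dG)
  then show "?G * (?L * ind_mat vs X) = ind_mat vs X"
    using X1 by (simp add: GLR)
  have "ind_mat vs X * (?L * ?G) = ind_mat vs X * transpose_mat ?R * (?R * (?L * ?G))"
    by (subst X2) (simp add: mult_assoc_dim dG)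
  then show "ind_mat vs X * (?L * ?G) = ind_mat vs X"
    using X2 by (simp add: RLG)
qed

end

section \<open>The Calderon projections\<close>

lemma partition_laplacian_add:
  assumes "edge_partition_of_unity es B Op Om pp pm" "\<sigma> \<in> carrier_vec (length es)"
  shows "laplacian vs es \<sigma> =
    laplacian vs es (vec_cmult pp \<sigma>) + laplacian vs es (vec_cmult pm \<sigma>)"
proof (rule laplacian_add)
  fix k assume k: "k < length es"
  then have "pp $ k + pm $ k = 1" using assms(1) by (simp add: edge_partition_of_unity_def)
  then have "(pp $ k + pm $ k) * \<sigma> $ k = \<sigma> $ k" by simp
  then show "\<sigma> $ k = vec_cmult pp \<sigma> $ k + vec_cmult pm \<sigma> $ k"
    using k assms(2) by (simp add: vec_cmult_def distrib_right)
qed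

text \<open>Every edge at a node of \<open>Om\<close> has p^- = 1, hence p^+ = 0, and carries no
  weight in sigma^+.\<close>

lemma partition_laplacian_plus_eq_0:
  assumes "edge_partition_of_unity es B Op Om pp pm" "\<sigma> \<in> carrier_vec (length es)"
    and "i < length vs" "j < length vs" "vs ! i \<in> Om"
  shows "laplacian vs es (vec_cmult pp \<sigma>) $$ (i, j) = 0" "laplacian vs es (vec_cmult pp \<sigma>) $$ (j, i) = 0"
proof -
  have "vec_cmult pp \<sigma> $ k = 0" if k: "k < length es" "vs ! i \<in> edge_of (es ! k)" for k
  proof -
    have "pm $ k = 1" "pp $ k + pm $ k = 1"
      using assms(1,5) k unfolding edge_partition_of_unity_def by blast+
    then show ?thesis using k(1) assms(2) by (simp add: vec_cmult_def)
  qed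
  from laplacian_eq_0[OF assms(3,4) this]
  show "laplacian vs es (vec_cmult pp \<sigma>) $$ (i, j) = 0" "laplacian vs es (vec_cmult pp \<sigma>) $$ (j, i) = 0"
    by auto
qed

text \<open>The mirror case: edges at a node of \<open>B\<close> or \<open>Op\<close> have p^+ = 1
  and carry no weight in sigma^-.\<close>

lemma partition_laplacian_minus_eq_0:
  assumes "edge_partition_of_unity es B Op Om pp pm" "\<sigma> \<in> carrier_vec (length es)"
    and "i < length vs" "j < length vs" "vs ! i \<in> B \<union> Op"
  shows "laplacian vs es (vec_cmult pm \<sigma>) $$ (i, j) = 0" "laplacian vs es (vec_cmult pm \<sigma>) $$ (j, i) = 0"
proof -
  have "vec_cmult pm \<sigma> $ k = 0" if k: "k < length es" "vs ! i \<in> edge_of (es ! k)" for k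
  proof -
    have "pp $ k = 1" "pp $ k + pm $ k = 1"
      using assms(1,5) k unfolding edge_partition_of_unity_def by blast+
    then show ?thesis using k(1) assms(2) by (simp add: vec_cmult_def)
  qed
  from laplacian_eq_0[OF assms(3,4) this]
  show "laplacian vs es (vec_cmult pm \<sigma>) $$ (i, j) = 0" "laplacian vs es (vec_cmult pm \<sigma>) $$ (j, i) = 0"
    by auto
qed

lemma complementary_idem:
  fixes F :: "'a :: ring_1 mat"
  assumes F: "F \<in> carrier_mat k k" and idem: "F * F = F"
  shows "(1\<^sub>m k - F) * (1\<^sub>m k - F) = 1\<^sub>m k - F"
proof -
  have "(1\<^sub>m k - F) * (1\<^sub>m k - F) = 1\<^sub>m k * (1\<^sub>m k - F) - F * (1\<^sub>m k - F)"
    using F by (intro minus_mult_distrib_mat) auto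
  also have "1\<^sub>m k * (1\<^sub>m k - F) = 1\<^sub>m k - F"
    using F by (intro left_mult_one_mat) auto
  also have "F * (1\<^sub>m k - F) = F - F"
    using F idem by (subst mult_minus_distrib_mat[of _ k k _ k]) auto
  also have "1\<^sub>m k - F - (F - F) = 1\<^sub>m k - F"
    using F by (intro eq_matI) auto
  finally show ?thesis .
qed

lemma pow_mat_2: "A \<in> carrier_mat k k \<Longrightarrow> A ^\<^sub>m 2 = A * A"
  by (simp add: numeral_2_eq_2)

theorem theorem3p3:
  fixes V B Op dO Om :: "'v set" and E :: "'v set set"
    and vs :: "'v list" and es :: "('v \<times> 'v) list"
    and \<sigma> pp pm :: "real vec"
  assumes graph: "simple_graph V E" "connected_graph V E"
    and part: "layer_partition V E B Op dO Om"
    and enum: "node_enum V vs" "edge_enum E es"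
    and cond: "\<sigma> \<in> carrier_vec (length es)" "\<forall>k<length es. 0 < \<sigma> $ k"
    and pou: "edge_partition_of_unity es B Op Om pp pm"
  shows "calderon_P_plus vs es \<sigma> B dO pp pm ^\<^sub>m 2 = calderon_P_plus vs es \<sigma> B dO pp pm
       \<and> calderon_P_minus vs es \<sigma> B dO pp pm ^\<^sub>m 2 = calderon_P_minus vs es \<sigma> B dO pp pm"
proof -
  define n m where "n = length vs" and "m = card dO"
  define G L Lp Lm where "G = green_mat vs es \<sigma> B" and "L = laplacian vs es \<sigma>"
    and "Lp = laplacian vs es (vec_cmult pp \<sigma>)" and "Lm = laplacian vs es (vec_cmult pm \<sigma>)"
  define Q Qp Qm where "Q = ind_mat vs dO" and "Qp = ind_mat vs (B \<union> Op)" and "Qm = ind_mat vs Om"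
  define g Tp Tm where "g = restr_mat vs dO" and "Tp = trace1_plus vs es \<sigma> dO pp"
    and "Tm = trace1_minus vs es \<sigma> dO pm"
  define gT where "gT = transpose_mat g"
  note V = part[unfolded layer_partition_def]
  have setvs: "set vs = V" "distinct vs" using enum(1) by (auto simp: node_enum_def)
  have cardP: "card (positions vs dO) = m"
    unfolding m_def using V setvs by (intro card_positions) auto
  have B: "B \<noteq> {}" "B \<subseteq> V" using V by auto
  note green = graph enum cond(2) B
  have sub: "dO \<subseteq> V - B" "Om \<subseteq> V - B" "Op \<subseteq> V - B" using V by auto
  have dims [simp]:
    "dim_row G = n" "dim_col G = n" "dim_row L = n" "dim_col L = n" "dim_row Lp = n" "dim_col Lp = n"
    "dim_row Lm = n" "dim_col Lm = n" "dim_row Q = n" "dim_col Q = n" "dim_row Qp = n" "dim_col Qp = n"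
    "dim_row Qm = n" "dim_col Qm = n" "dim_row g = m" "dim_col g = n" "dim_row gT = n" "dim_col gT = m"
    using carrier_matD[OF green_mat_carrier[OF green]]
    by (simp_all add: G_def L_def Lp_def Lm_def Q_def Qp_def Qm_def g_def gT_def n_def cardP)
  have Tp: "Tp = - (g * Lp)" and Tm: "Tm = g * Lm"
    by (simp_all add: Tp_def Tm_def trace1_plus_def trace1_minus_def g_def Lp_def Lm_def)
  have TmT: "transpose_mat Tm = Lm * gT" and TpT: "transpose_mat Tp = - (Lp * gT)"
    by (simp_all add: Tm Tp transpose_mult_dim transpose_uminus gT_def)
      (simp_all add: Lm_def Lp_def)
  have L: "L = Lp + Lm"
    unfolding L_def Lp_def Lm_def by (rule partition_laplacian_add[OF pou cond(1)])

  \<comment> \<open>Trace and coordinate projection identities\<close>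
  have ggT: "g * gT = 1\<^sub>m m" and gTg: "gT * g = Q"
    by (simp_all add: g_def gT_def Q_def restr_mat_mult_transpose transpose_mult_restr_mat cardP)
  have gQ: "g * Q = g" and QgT: "Q * gT = gT"
    by (simp_all add: g_def gT_def Q_def restr_mat_mult_ind_mat ind_mat_mult_restr_transpose)
  have gQm: "g * Qm = 0\<^sub>m m n"
    using V unfolding g_def Qm_def n_def cardP[symmetric]
    by (intro restr_mat_mult_ind_mat_disjoint) auto
  have LpQm: "Lp * Qm = 0\<^sub>m n n"
    unfolding Qm_def Lp_def n_def ind_mat_mult_right[OF laplacian_carrier]
    using partition_laplacian_plus_eq_0[OF pou cond(1)] by (auto intro!: eq_matI)
  have QpLm: "Qp * Lm = 0\<^sub>m n n"
    unfolding Qp_def Lm_def n_def ind_mat_mult_left[OF laplacian_carrier]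
    using partition_laplacian_minus_eq_0[OF pou cond(1)] by (auto intro!: eq_matI)
  have QpgT: "Qp * gT = 0\<^sub>m n m"
  proof -
    have "g * Qp = 0\<^sub>m m n"
      using V unfolding g_def Qp_def n_def cardP[symmetric]
      by (intro restr_mat_mult_ind_mat_disjoint) auto
    moreover have "transpose_mat (g * Qp) = transpose_mat Qp * gT"
      by (simp add: transpose_mult_dim gT_def)
    ultimately have "transpose_mat Qp * gT = 0\<^sub>m n m" by simp
    moreover have "transpose_mat Qp = Qp"
      by (auto intro!: eq_matI simp: Qp_def ind_mat_def mat_diag_def)
    ultimately show ?thesis by simp
  qed

  \<comment> \<open>Green function identities\<close>
  have GLgT: "G * (L * gT) = gT"
    using arg_cong[OF green_laplacian[OF green sub(1)], of "\<lambda>A. A * gT", folded G_def L_def Q_def]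
    by (simp add: mult_assoc_dim QgT)
  have gLG: "g * (L * G) = g"
    using arg_cong[OF laplacian_green[OF green sub(1)], of "\<lambda>A. g * A", folded G_def L_def Q_def]
    by (simp add: gQ flip: mult_assoc_dim)
  have GLG: "G * (L * G) = G"
    using arg_cong[OF green_laplacian[OF green order_refl], of "\<lambda>A. A * G", folded G_def L_def]
    by (simp add: mult_assoc_dim ind_green[OF green, folded G_def] n_def)
  have GLQmG: "G * (L * (Qm * G)) = Qm * G"
    using arg_cong[OF green_laplacian[OF green sub(2)], of "\<lambda>A. A * G", folded G_def L_def Qm_def]
    by (simp add: mult_assoc_dim)
  have GQpLG: "G * (Qp * (L * G)) = G * Qp"
  proof -
    \<comment> \<open>\<open>Qp\<close> also covers \<open>B\<close>, where L G is not the identity.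
      As G has zero columns at \<open>B\<close>, the projection onto \<open>Op\<close> can replace
      \<open>Qp\<close> to the right of G.\<close>
    have *: "G * Qp = G * ind_mat vs Op"
    proof -
      have "G * Qp = G * ind_mat vs (V - B) * Qp"
        by (simp add: green_ind[OF green, folded G_def])
      also have "\<dots> = G * ind_mat vs ((V - B) \<inter> (B \<union> Op))"
        by (simp add: Qp_def mult_assoc_dim ind_mat_mult n_def)
      also have "(V - B) \<inter> (B \<union> Op) = Op" using V by auto
      finally show ?thesis .
    qed
    have "G * (Qp * (L * G)) = G * (ind_mat vs Op * (L * G))"
      using arg_cong[OF *, of "\<lambda>A. A * (L * G)"] by (simp add: mult_assoc_dim n_def)
    then show ?thesis
      by (simp add: laplacian_green[OF green sub(3), folded G_def L_def] *)
  qed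

  \<comment> \<open>The middle factor of the squared projection\<close>
  define M where "M = Lm * Q + Q * Lp"
  have dM [simp]: "dim_row M = n" "dim_col M = n" by (simp_all add: M_def)
  \<comment> \<open>Checked entrywise, according to the regions of the nodes \<open>i\<close> and
    \<open>j\<close>. For a row in \<open>B\<close> or \<open>Op\<close> and a column in
    \<open>Om\<close>, both correction terms contribute the entry of L; this is harmless because
    \<open>Lp\<close> vanishes at the column and \<open>Lm\<close> at the row, so that entry is
    zero.\<close>
  have LM: "L = M + L * Qm + Qp * L"
  proof (rule eq_matI)
    fix i j assume "i < dim_row (M + L * Qm + Qp * L)" "j < dim_col (M + L * Qm + Qp * L)"
    then have ij: "i < length vs" "j < length vs" by (auto simp: n_def)
    have c: "Lp \<in> carrier_mat (length vs) (length vs)" "Lm \<in> carrier_mat (length vs) (length vs)"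
      "L \<in> carrier_mat (length vs) (length vs)"
      by (auto simp: n_def intro!: carrier_matI)
    have entry: "(M + L * Qm + Qp * L) $$ (i, j) =
        (if vs ! j \<in> dO then Lm $$ (i, j) else 0) + (if vs ! i \<in> dO then Lp $$ (i, j) else 0)
        + (if vs ! j \<in> Om then L $$ (i, j) else 0) + (if vs ! i \<in> B \<union> Op then L $$ (i, j) else 0)"
      using ij unfolding M_def Q_def Qm_def Qp_def
        ind_mat_mult_right[OF c(2)] ind_mat_mult_right[OF c(3)]
        ind_mat_mult_left[OF c(1)] ind_mat_mult_left[OF c(3)]
      by simp
    have Lij: "L $$ (i, j) = Lp $$ (i, j) + Lm $$ (i, j)"
      unfolding L using ij by (simp add: n_def)
    have "vs ! i \<in> V" "vs ! j \<in> V" using ij setvs by auto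
    then have cases: "vs ! i \<in> B \<union> Op \<or> vs ! i \<in> dO \<or> vs ! i \<in> Om"
      "vs ! j \<in> B \<union> Op \<or> vs ! j \<in> dO \<or> vs ! j \<in> Om"
      using V by auto
    have excl: "(v \<in> B \<union> Op \<longrightarrow> v \<notin> dO \<and> v \<notin> Om) \<and> (v \<in> dO \<longrightarrow> v \<notin> Om)" for v
      using V by blast
    have zero: "vs ! i \<in> Om \<Longrightarrow> Lp $$ (i, j) = 0" "vs ! j \<in> Om \<Longrightarrow> Lp $$ (i, j) = 0"
      "vs ! i \<in> B \<union> Op \<Longrightarrow> Lm $$ (i, j) = 0" "vs ! j \<in> B \<union> Op \<Longrightarrow> Lm $$ (i, j) = 0"
      unfolding Lp_def Lm_def
      by (fact partition_laplacian_plus_eq_0(1)[OF pou cond(1) ij]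
          partition_laplacian_plus_eq_0(2)[OF pou cond(1) ij(2,1)]
          partition_laplacian_minus_eq_0(1)[OF pou cond(1) ij]
          partition_laplacian_minus_eq_0(2)[OF pou cond(1) ij(2,1)])+
    show "L $$ (i, j) = (M + L * Qm + Qp * L) $$ (i, j)"
      unfolding entry Lij using cases
      by (elim disjE) (use zero excl[of "vs ! i"] excl[of "vs ! j"] in \<open>auto simp del: Un_iff\<close>)
  qed simp_all
  \<comment> \<open>Insert \<open>LM\<close> into G L G = G. The corrections collapse because G L
    and L G act as the identity next to projections off \<open>B\<close>.\<close>
  have decomp: "G = G * (M * G) + Qm * G + G * Qp"
  proof -
    have "G = G * ((M + L * Qm + Qp * L) * G)"
      using GLG by (simp add: LM[symmetric])
    also have "\<dots> = G * (M * G) + G * (L * (Qm * G)) + G * (Qp * (L * G))"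
      by (simp add: mat_dim_algebra)
    finally show ?thesis by (simp only: GLQmG GQpLG)
  qed

  \<comment> \<open>Idempotence of the factored matrix\<close>
  define F where "F = four_block_mat (g * G * (Lm * gT)) (g * G * - gT) (Tp * G * (Lm * gT)) (Tp * G * - gT)"
  have dTp [simp]: "dim_row Tp = m" "dim_col Tp = n" by (simp_all add: Tp)
  \<comment> \<open>This is \<open>b1 * a1 + b2 * a2\<close> for the column (\<open>g\<close>,
    \<open>Tp\<close>) and the row (\<open>Lm * gT\<close>, \<open>- gT\<close>), where
    \<open>Lm * gT\<close> is the transpose of \<open>Tm\<close>.\<close>
  have M_eq: "Lm * gT * g + - gT * Tp = M"
    by (simp add: M_def Tp mult_assoc_dim gTg) (simp add: gTg flip: mult_assoc_dim)
  have neg0 [simp]: "- 0\<^sub>m k l = (0\<^sub>m k l :: real mat)" for k l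
    by (rule eq_matI) auto
  have FF: "F * F = F"
    unfolding F_def
  proof (rule four_block_sandwich_idem[where n = n and m = m])
    fix a b assume a: "a \<in> {g, Tp}" and b: "b \<in> {Lm * gT, - gT}"
    have da [simp]: "dim_row a = m" "dim_col a = n" and db [simp]: "dim_row b = n" "dim_col b = m"
      using a b by auto
    \<comment> \<open>Both left factors kill the correction \<open>Qm * G\<close>: the trace
      \<open>g\<close> lives on \<open>dO\<close>, and \<open>Lp\<close> vanishes on
      \<open>Om\<close>. Dually, both right factors are killed by \<open>Qp\<close>, which disposes
      of \<open>G * Qp\<close>.\<close>
    have "Tp * Qm = 0\<^sub>m m n"
      by (simp add: Tp mult_assoc_dim LpQm mult_zero_dim)
    with a have aQm: "a * Qm = 0\<^sub>m m n" using gQm by auto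
    have "Qp * (Lm * gT) = 0\<^sub>m n m"
      by (simp add: QpLm mult_zero_dim flip: mult_assoc_dim)
    with b have Qpb: "Qp * b = 0\<^sub>m n m" using QpgT by auto
    have "a * G * b = a * (G * (M * G) + Qm * G + G * Qp) * b"
      using decomp by simp
    also have "\<dots> = a * (G * (M * (G * b))) + a * Qm * (G * b) + a * (G * (Qp * b))"
      by (simp add: mat_dim_algebra)
    also have "\<dots> = a * (G * M * G) * b"
      by (simp add: aQm Qpb mult_zero_dim add_zero_dim) (simp add: mat_dim_algebra)
    finally show "a * (G * (Lm * gT * g + - gT * Tp) * G) * b = a * G * b"
      by (simp only: M_eq)
  qed (auto intro!: carrier_matI)
  have F: "F \<in> carrier_mat (2 * m) (2 * m)"
    unfolding F_def mult_2 by (intro four_block_carrier_mat carrier_matI) auto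

  \<comment> \<open>Identification of the factored matrix with the layer operators\<close>
  define X where "X = g * (G * (Lm * gT))"
  define Y where "Y = g * (Lm * (G * gT))"
  have dXY [simp]: "dim_row X = m" "dim_col X = m" "dim_row Y = m" "dim_col Y = m"
    by (simp_all add: X_def Y_def)
  \<comment> \<open>The jump relation for the double layer: \<open>X\<close> is the trace of D^-,
    and \<open>g * (G * (Lp * gT))\<close> is minus the trace of D^+. The relation \<open>Y\<close>
    is the analogous jump of the conormal traces of the single layer.\<close>
  have X: "g * (G * (Lp * gT)) + X = 1\<^sub>m m"
  proof -
    have "g * (G * (L * gT)) = g * (G * (Lp * gT)) + X"
      unfolding L X_def by (simp add: mat_dim_algebra)
    then show ?thesis by (simp add: GLgT ggT)
  qed
  have Y: "g * (Lp * (G * gT)) + Y = 1\<^sub>m m"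
  proof -
    have "g * (L * G) * gT = g * (Lp * (G * gT)) + Y"
      unfolding L Y_def by (simp add: mat_dim_algebra)
    then show ?thesis by (simp add: gLG ggT)
  qed
  define Z where "Z = g * (Lp * (G * gT))"
  have dZ [simp]: "dim_row Z = m" "dim_col Z = m" by (simp_all add: Z_def)
  define W where "W = g * (G * (Lp * gT))"
  have dW [simp]: "dim_row W = m" "dim_col W = m" by (simp_all add: W_def)
  have entry: "W $$ (i, j) + X $$ (i, j) = (if i = j then 1 else 0)"
    "Z $$ (i, j) + Y $$ (i, j) = (if i = j then 1 else 0)" if "i < m" "j < m" for i j
    using arg_cong[OF X, of "\<lambda>A. A $$ (i, j)"] arg_cong[OF Y, of "\<lambda>A. A $$ (i, j)"] that
    by (simp_all add: W_def Z_def)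
  \<comment> \<open>Since \<open>W + X\<close> and \<open>Z + Y\<close> are the identity, D = X -
    I/2 and D' = I/2 - Z. Hence the diagonal blocks of C are I/2 - X and I/2 - Z, which absorbs the
    halves in the projections.\<close>
  have D: "bl_D vs es \<sigma> B dO pp pm = (1/2) \<cdot>\<^sub>m (X - W)"
    unfolding bl_D_def double_layer_plus_def double_layer_minus_def trace0_def
      Tp_def[symmetric] Tm_def[symmetric] G_def[symmetric] g_def[symmetric] TpT TmT
    by (simp add: mat_dim_algebra flip: X_def W_def) (auto intro!: eq_matI)
  have D': "bl_D' vs es \<sigma> B dO pp pm = (1/2) \<cdot>\<^sub>m (Y - Z)"
    unfolding bl_D'_def single_layer_def trace0_def
      Tp_def[symmetric] Tm_def[symmetric] G_def[symmetric] g_def[symmetric] gT_def[symmetric] Tp Tm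
    by (simp add: mat_dim_algebra flip: Y_def Z_def) (auto intro!: eq_matI)
  have S: "bl_S vs es \<sigma> B dO = - (g * G * - gT)"
    unfolding bl_S_def single_layer_def trace0_def G_def[symmetric] g_def[symmetric] gT_def[symmetric]
    by (simp add: mult_assoc_dim)
  have H: "bl_H vs es \<sigma> B dO pp pm = - (Tp * G * (Lm * gT))"
    unfolding bl_H_def double_layer_minus_def
      Tp_def[symmetric] Tm_def[symmetric] G_def[symmetric] TmT
    by (simp add: mult_assoc_dim)
  have F11: "g * G * (Lm * gT) = X" by (simp add: X_def mult_assoc_dim)
  have F22: "Tp * G * - gT = Z" by (simp add: Z_def Tp mult_assoc_dim)
  have C: "calderon_C vs es \<sigma> B dO pp pm = (1/2) \<cdot>\<^sub>m 1\<^sub>m (2 * m) - F"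
  proof (rule eq_matI)
    fix i j assume "i < dim_row ((1/2) \<cdot>\<^sub>m 1\<^sub>m (2 * m) - F)" "j < dim_col ((1/2) \<cdot>\<^sub>m 1\<^sub>m (2 * m) - F)"
    then have ij: "i < 2 * m" "j < 2 * m" using F by auto
    \<comment> \<open>The bounds hold in all four blocks: for \<open>i < m\<close> truncated
      subtraction gives \<open>i - m = 0\<close>, and \<open>i < 2 * m\<close> forces
      \<open>0 < m\<close>.\<close>
    have shift: "i - m < m" "j - m < m" "\<not> i < m \<Longrightarrow> \<not> j < m \<Longrightarrow> i - m = j - m \<longleftrightarrow> i = j"
      using ij by linarith+
    show "calderon_C vs es \<sigma> B dO pp pm $$ (i, j) = ((1/2) \<cdot>\<^sub>m 1\<^sub>m (2 * m) - F) $$ (i, j)"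
      \<comment> \<open>Products are kept opaque here: the off-diagonal blocks agree as they stand,
        and the diagonal ones follow from the entrywise jump relations.\<close>
      using ij shift entry[of i j] entry[OF shift(1,2)]
      unfolding calderon_C_def F_def D D' S H F11 F22
      by (auto simp del: uminus_mult_left_mat uminus_mult_right_mat
          index_mult_mat(1) split: if_splits)
        (simp add: field_simps)
  qed (use F in \<open>auto simp: calderon_C_def D D'\<close>)
  have Pp: "calderon_P_plus vs es \<sigma> B dO pp pm = F"
    unfolding calderon_P_plus_def m_def[symmetric] C using F by (intro eq_matI) auto
  have Pm: "calderon_P_minus vs es \<sigma> B dO pp pm = 1\<^sub>m (2 * m) - F"
    unfolding calderon_P_minus_def m_def[symmetric] C using F by (intro eq_matI) auto
  have "1\<^sub>m (2 * m) - F \<in> carrier_mat (2 * m) (2 * m)" using F by auto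
  then show ?thesis
    unfolding Pp Pm by (simp add: pow_mat_2[of _ "2 * m"] F FF complementary_idem)
qed

end
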